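(* Fix an integer $r\ge1$ and constants $K>0$, $C>0$. For each sample size $n$ let $n_1<n_2<\dots<n_r$ be positive integers (depending on $n$) with $n_r\le n\le Kn_1$, and suppose that $C_i=\prod_{j\ne i}\frac{n_i}{n_i-n_j}$ satisfy $\sum_{i=1}^r|C_i|\le C$, with $C$ not depending on $n$. Let $\hat f_r$ be the corresponding $r$-jackknife estimator of $f(p)$. If $f(p)=-p\ln p$, then $\|f(p)-\mathbb{E}_p\hat f_r\|\asymp_{r,C}\frac1n$. If $f(p)=p^\alpha$ with $0<\alpha<1$, then $\|f(p)-\mathbb{E}_p\hat f_r\|\asymp_{r,C}\frac1{n^\alpha}$.
   Context: All norms are supremum norms over $p\in[0,1]$; $0\ln0=0$. The $r$-jackknife estimator is $\hat f_r=\sum_{i=1}^rC_i\,\mathbb{U}_{n,i}$, where $\mathbb{U}_{n,i}$ is the average of $f\big(\frac1{n_i}\sum_{k\in S}X_k\big)$ over all subsets $S\subset\{1,\dots,n\}$ of size $n_i$, and $X_1,\dots,X_n$ are i.i.d. $\mathrm{Bernoulli}(p)$. Thus $\mathbb{E}_p\hat f_r=\sum_{i=1}^rC_i\,\mathbb{E}_pf(\hat p_{n_i})$, where $m\hat p_m\sim\mathrm{Binomial}(m,p)$. $a\asymp_\theta b$ means that $a\le Mb$ and $b\le Ma$ for all $n$, with a constant $M$ depending only on $\theta$. The constants $K$ and, in the second statement, $\alpha$ are fixed, and the implied constants may depend on them. *)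

theory Defs
  imports "HOL-Probability.Probability"
begin

definition unorm :: "(real \<Rightarrow> real) \<Rightarrow> real" where
  "unorm g = (SUP p\<in>{0..1}. \<bar>g p\<bar>)"

definition ustat :: "nat \<Rightarrow> nat \<Rightarrow> (real \<Rightarrow> real) \<Rightarrow> (nat \<Rightarrow> real) \<Rightarrow> real" where
  "ustat n m f x =
     (\<Sum>S\<in>{S. S \<subseteq> {1..n} \<and> card S = m}. f ((1 / real m) * (\<Sum>k\<in>S. x k)))
       / real (card {S. S \<subseteq> {1..n} \<and> card S = m})"

definition jack_coeff :: "nat \<Rightarrow> (nat \<Rightarrow> nat) \<Rightarrow> nat \<Rightarrow> real" where
  "jack_coeff r ns i = (\<Prod>j\<in>{1..r} - {i}. real (ns i) / (real (ns i) - real (ns j)))"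

definition jackknife ::
  "nat \<Rightarrow> (nat \<Rightarrow> nat) \<Rightarrow> nat \<Rightarrow> (real \<Rightarrow> real) \<Rightarrow> (nat \<Rightarrow> real) \<Rightarrow> real" where
  "jackknife r ns n f x = (\<Sum>i=1..r. jack_coeff r ns i * ustat n (ns i) f x)"

definition bernoulli_sample :: "nat \<Rightarrow> real \<Rightarrow> (nat \<Rightarrow> real) pmf" where
  "bernoulli_sample n p = Pi_pmf {1..n} 0 (\<lambda>_. map_pmf of_bool (bernoulli_pmf p))"

definition jackknife_mean ::
  "nat \<Rightarrow> (nat \<Rightarrow> nat) \<Rightarrow> nat \<Rightarrow> (real \<Rightarrow> real) \<Rightarrow> real \<Rightarrow> real" where
  "jackknife_mean r ns n f p =
     measure_pmf.expectation (bernoulli_sample n p) (jackknife r ns n f)"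

definition jackknife_sizes :: "nat \<Rightarrow> real \<Rightarrow> real \<Rightarrow> nat \<Rightarrow> (nat \<Rightarrow> nat) \<Rightarrow> bool" where
  "jackknife_sizes r K C n ns \<longleftrightarrow>
     (\<forall>i\<in>{1..r}. 0 < ns i) \<and> strict_mono_on {1..r} ns \<and>
     ns r \<le> n \<and> real n \<le> K * real (ns 1) \<and>
     (\<Sum>i=1..r. \<bar>jack_coeff r ns i\<bar>) \<le> C"

text \<open>
  Two-sided comparison of a(n) and b(n), where a(n) also depends on the subsample
  sizes chosen for n. The constant is chosen before n and the sizes, so it is uniform
  over all admissible choices. Sample sizes n admitting no such choice (e.g. n < r)
  impose no condition.
\<close>
definition jackknife_asymp ::
  "nat \<Rightarrow> real \<Rightarrow> real \<Rightarrow> (nat \<Rightarrow> (nat \<Rightarrow> nat) \<Rightarrow> real) \<Rightarrow> (nat \<Rightarrow> real) \<Rightarrow> bool" where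
  "jackknife_asymp r K C a b \<longleftrightarrow>
     (\<exists>M>0. \<forall>n ns. jackknife_sizes r K C n ns \<longrightarrow> a n ns \<le> M * b n \<and> b n \<le> M * a n ns)"

end

theory Submission
  imports Defs "HOL-Computational_Algebra.Polynomial"
begin

text \<open>
  The jackknife mean is a combination of Bernstein operators with coefficients summing to 1.
  Each \<open>f\<close> lies below its tangent at \<open>p\<close>, and above the tangent minus
  \<open>(x - p)\<^sup>2 / p\<close> resp. \<open>p powr \<alpha> * ((x - p) / p)\<^sup>2\<close>; since the binomial proportion has mean
  \<open>p\<close> and variance \<open>p (1 - p) / m\<close>, this gives the upper bounds (for powers when \<open>p\<close> exceeds
  \<open>1 / m\<close>; below that, \<open>p powr \<alpha>\<close> is itself small enough).

  For the lower bounds take \<open>p = x / n\<close> with a small constant \<open>x\<close>: the binomial count \<open>k\<close> then has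
  mean at most \<open>x\<close>, so the operators contribute only \<open>O(x)\<close> in units of \<open>n powr -\<alpha>\<close> resp. \<open>1 / n\<close>,
  whereas \<open>f p\<close> contributes \<open>x powr \<alpha>\<close> resp. \<open>- x ln x\<close>. In the entropy case the linear function
  \<open>p ln n\<close>, which the jackknife reproduces exactly, is subtracted first.
\<close>

section \<open>Bernstein operators: moments and bias under tangent bounds\<close>

text \<open>The Bernstein operator: for \<open>p\<close> in [0,1] it is the mean of \<open>f\<close>
  at a binomial proportion, and \<open>expectation_subset_mean\<close> connects it with the
  sample.\<close>

definition bern :: "nat \<Rightarrow> (real \<Rightarrow> real) \<Rightarrow> real \<Rightarrow> real" where
  "bern m f p = (\<Sum>k\<le>m. f (real k / real m) * Bernstein m k p)"

lemma bern_mono: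
  assumes "p \<in> {0..1}" and "\<And>k. k \<le> m \<Longrightarrow> f (real k / real m) \<le> g (real k / real m)"
  shows "bern m f p \<le> bern m g p"
  unfolding bern_def
  using assms by (intro sum_mono mult_right_mono) (auto simp: Bernstein_nonneg)

lemma abs_bern_le:
  assumes "p \<in> {0..1}" and "\<And>k. k \<le> m \<Longrightarrow> \<bar>f (real k / real m)\<bar> \<le> g (real k / real m)"
  shows "\<bar>bern m f p\<bar> \<le> bern m g p"
proof -
  have "\<bar>bern m f p\<bar> \<le> bern m (\<lambda>x. \<bar>f x\<bar>) p"
    unfolding bern_def
    by (rule order_trans[OF sum_abs]) (use assms in \<open>auto simp: abs_mult Bernstein_nonneg\<close>)
  also have "\<dots> \<le> bern m g p"
    by (rule bern_mono) (use assms in auto)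
  finally show ?thesis .
qed

text \<open>Test functions are expanded in 1, k, k(k-1) with k = \<open>m * x\<close>, because the
  factorial moments of the binomial law are known as Bernstein sums.\<close>

lemma bern_factorial_moments:
  assumes "m > 0"
  shows "bern m (\<lambda>x. a + b * (real m * x) + c * ((real m * x) * (real m * x - 1))) p
       = a + b * (real m * p) + c * (real m * (real m - 1) * p\<^sup>2)"
proof -
  have "bern m (\<lambda>x. a + b * (real m * x) + c * ((real m * x) * (real m * x - 1))) p =
     (\<Sum>k\<le>m. a * Bernstein m k p + b * (real k * Bernstein m k p)
        + c * (real k * (real k - 1) * Bernstein m k p))"
    unfolding bern_def using assms by (intro sum.cong) (auto simp: algebra_simps)
  also have "\<dots> = a + b * (real m * p) + c * (real m * (real m - 1) * p\<^sup>2)"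
    by (simp only: sum.distrib sum_distrib_left[symmetric] sum_Bernstein sum_k_Bernstein
          sum_kk_Bernstein mult_1_right)
  finally show ?thesis .
qed

lemma bern_quadratic:
  assumes "m > 0"
  shows "bern m (\<lambda>x. a + b * (x - p) + c * (x - p)\<^sup>2) p = a + c * (p * (1 - p) / real m)"
proof -
  have "bern m (\<lambda>x. a + b * (x - p) + c * (x - p)\<^sup>2) p =
    bern m (\<lambda>x. (a - b * p + c * p\<^sup>2) + (b / m - 2 * c * p / m + c / m\<^sup>2) * (real m * x)
        + (c / m\<^sup>2) * ((real m * x) * (real m * x - 1))) p"
    using assms by (intro arg_cong[where f = "\<lambda>f. bern m f p"] ext)
      (simp add: field_simps power2_eq_square)
  also have "\<dots> = a + c * (p * (1 - p) / real m)"
    using assms by (subst bern_factorial_moments) (simp_all add: field_simps power2_eq_square)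
  finally show ?thesis .
qed

lemma bern_at_0: "bern m f 0 = f 0"
proof -
  have "bern m f 0 = (\<Sum>k\<le>m. if k = 0 then f 0 else 0)"
    unfolding bern_def by (intro sum.cong) (auto simp: Bernstein_def)
  then show ?thesis by simp
qed

lemma bern_add_linear:
  assumes "m > 0"
  shows "bern m (\<lambda>x. f x + c * x) p = bern m f p + c * p"
proof -
  have "bern m (\<lambda>x. f x + c * x) p = bern m f p
      + bern m (\<lambda>x. 0 + c / m * (m * x) + 0 * (m * x * (m * x - 1))) p"
    unfolding bern_def using assms by (simp add: sum.distrib algebra_simps)
  then show ?thesis
    using assms by (subst (asm) bern_factorial_moments) auto
qed

text \<open>The proportion has mean \<open>p\<close>, so the slope \<open>b\<close> drops out. The
  tangent from above makes \<open>f p - bern m f p\<close> nonnegative, and the bound from below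
  costs \<open>c\<close> times the variance, in which 1 - p is bounded by 1.\<close>

lemma abs_bern_bias_le:
  assumes "m > 0" "p \<in> {0..1}" "c \<ge> 0"
    and up: "\<And>x. x \<ge> 0 \<Longrightarrow> f x \<le> f p + b * (x - p)"
    and lo: "\<And>x. x \<ge> 0 \<Longrightarrow> f p + b * (x - p) - c * (x - p)\<^sup>2 \<le> f x"
  shows "\<bar>f p - bern m f p\<bar> \<le> c * (p / real m)"
proof -
  have "bern m f p \<le> bern m (\<lambda>x. f p + b * (x - p) + 0 * (x - p)\<^sup>2) p"
    by (rule bern_mono) (use assms in auto)
  then have 1: "bern m f p \<le> f p"
    using assms(1) by (subst (asm) bern_quadratic) auto
  have "bern m (\<lambda>x. f p + b * (x - p) + (- c) * (x - p)\<^sup>2) p \<le> bern m f p"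
    by (rule bern_mono) (use assms in auto)
  then have 2: "f p - c * (p * (1 - p) / real m) \<le> bern m f p"
    using assms(1) by (subst (asm) bern_quadratic) auto
  have "c * (p * (1 - p) / real m) \<le> c * (p / real m)"
    using assms by (intro mult_left_mono divide_right_mono) (auto simp: mult_left_le)
  with 1 2 show ?thesis by linarith
qed

section \<open>Tangent inequalities and upper bounds on the operator bias\<close>

text \<open>Both bounds come from ln u <= u - 1, at u = p/x and at u = x/p, after multiplication by
  \<open>x\<close>.\<close>

lemma xlnx_tangent:
  fixes x p :: real
  assumes "p > 0" "x \<ge> 0"
  shows "- x * ln x \<le> - p * ln p + (- ln p - 1) * (x - p)"
    and "- p * ln p + (- ln p - 1) * (x - p) - 1 / p * (x - p)\<^sup>2 \<le> - x * ln x"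
proof -
  consider "x = 0" | "x > 0" using assms by linarith
  then have *: "x * (ln p - ln x) \<le> p - x \<and> x * (ln x - ln p) \<le> x * (x / p - 1)"
  proof cases
    case 2
    have "ln (p / x) \<le> p / x - 1" "ln (x / p) \<le> x / p - 1"
      using 2 assms by (auto intro!: ln_le_minus_one)
    then have "x * ln (p / x) \<le> x * (p / x - 1)" "x * ln (x / p) \<le> x * (x / p - 1)"
      using 2 by auto
    then show ?thesis
      using 2 assms by (auto simp: ln_div right_diff_distrib)
  qed (use assms in auto)
  from * show "- x * ln x \<le> - p * ln p + (- ln p - 1) * (x - p)"
    by (simp add: algebra_simps)
  have "x * (x / p - 1) = 1 / p * (x - p)\<^sup>2 + (x - p)"
    using assms by (simp add: field_simps power2_eq_square)
  with * show "- p * ln p + (- ln p - 1) * (x - p) - 1 / p * (x - p)\<^sup>2 \<le> - x * ln x"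
    by (simp add: algebra_simps)
qed

text \<open>The case p = 1. The upper bound is the weighted AM-GM inequality for \<open>t\<close>
  and 1. The lower bound linearises \<open>t powr (\<alpha> - 1)\<close> from below and multiplies
  by \<open>t\<close>, which leaves the remainder (1 - \<alpha>)(t - 1)^2.\<close>

lemma powr_tangent_1:
  fixes t \<alpha> :: real
  assumes "0 < \<alpha>" "\<alpha> < 1" "t \<ge> 0"
  shows "t powr \<alpha> \<le> 1 + \<alpha> * (t - 1)"
    and "1 + \<alpha> * (t - 1) - (t - 1)\<^sup>2 \<le> t powr \<alpha>"
proof -
  show "t powr \<alpha> \<le> 1 + \<alpha> * (t - 1)"
    using Youngs_inequality_0[of \<alpha> "1 - \<alpha>" t 1] assms
    by (cases "t = 0") (simp_all add: algebra_simps)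
  show "1 + \<alpha> * (t - 1) - (t - 1)\<^sup>2 \<le> t powr \<alpha>"
  proof (cases "t = 0")
    case False
    then have t: "t > 0" using assms by simp
    have "1 + (\<alpha> - 1) * (t - 1) \<le> 1 + (\<alpha> - 1) * ln t"
      using assms t ln_le_minus_one[of t] by (simp add: mult_left_mono_neg)
    also have "\<dots> \<le> t powr (\<alpha> - 1)"
      using t exp_ge_add_one_self[of "(\<alpha> - 1) * ln t"] by (simp add: powr_def)
    finally have "t * (1 + (\<alpha> - 1) * (t - 1)) \<le> t * t powr (\<alpha> - 1)"
      using t by simp
    also have "t * t powr (\<alpha> - 1) = t powr \<alpha>"
      using t by (simp add: powr_mult_base)
    moreover have "t * (1 + (\<alpha> - 1) * (t - 1)) = 1 + \<alpha> * (t - 1) - (1 - \<alpha>) * (t - 1)\<^sup>2"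
      by (simp add: algebra_simps power2_eq_square)
    moreover have "(1 - \<alpha>) * (t - 1)\<^sup>2 \<le> (t - 1)\<^sup>2"
      using assms by (intro mult_left_le_one_le) auto
    ultimately show ?thesis by linarith
  qed (use assms in auto)
qed

text \<open>Homogeneity reduces this to \<open>powr_tangent_1\<close> at t = x/p.\<close>

lemma powr_tangent:
  fixes x p \<alpha> :: real
  assumes "0 < \<alpha>" "\<alpha> < 1" "p > 0" "x \<ge> 0"
  shows "x powr \<alpha> \<le> p powr \<alpha> + \<alpha> * p powr \<alpha> / p * (x - p)"
    and "p powr \<alpha> + \<alpha> * p powr \<alpha> / p * (x - p) - p powr \<alpha> / p\<^sup>2 * (x - p)\<^sup>2 \<le> x powr \<alpha>"
proof -
  have t: "x / p \<ge> 0" using assms by simp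
  have x: "x powr \<alpha> = p powr \<alpha> * (x / p) powr \<alpha>"
    using assms by (simp add: powr_divide)
  have "x powr \<alpha> \<le> p powr \<alpha> * (1 + \<alpha> * (x / p - 1))"
    unfolding x by (intro mult_left_mono powr_tangent_1 assms t) auto
  also have "\<dots> = p powr \<alpha> + \<alpha> * p powr \<alpha> / p * (x - p)"
    using assms by (simp add: field_simps)
  finally show "x powr \<alpha> \<le> p powr \<alpha> + \<alpha> * p powr \<alpha> / p * (x - p)" .
  have "p powr \<alpha> + \<alpha> * p powr \<alpha> / p * (x - p) - p powr \<alpha> / p\<^sup>2 * (x - p)\<^sup>2
      = p powr \<alpha> * (1 + \<alpha> * (x / p - 1) - (x / p - 1)\<^sup>2)"
    using assms by (simp add: field_simps power2_eq_square)
  also have "\<dots> \<le> x powr \<alpha>"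
    unfolding x by (intro mult_left_mono powr_tangent_1 assms t) auto
  finally show "p powr \<alpha> + \<alpha> * p powr \<alpha> / p * (x - p) - p powr \<alpha> / p\<^sup>2 * (x - p)\<^sup>2 \<le> x powr \<alpha>" .
qed

text \<open>The curvature constant 1/p cancels the factor p of the variance, so the bound is uniform
  in \<open>p\<close> without a separate regime near 0.\<close>

lemma abs_bern_bias_xlnx_le:
  assumes "m > 0" "p \<in> {0..1}"
  shows "\<bar>- p * ln p - bern m (\<lambda>p. - p * ln p) p\<bar> \<le> 1 / real m"
\<comment> \<open>The tangent bounds require p > 0; at p = 0 the operator reproduces the function
  value exactly.\<close>
proof (cases "p = 0")
  case False
  then have "p > 0" using assms by simp
  then show ?thesis
    using abs_bern_bias_le[OF assms, of "1 / p" "\<lambda>p. - p * ln p", OF _ xlnx_tangent] by simp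
qed (simp add: bern_at_0)

text \<open>The curvature bound \<open>p powr (\<alpha> - 1) / m\<close> blows up at 0, while the
  bound \<open>p powr \<alpha>\<close> from concavity grows with \<open>p\<close>. They cross at p =
  1/m, where both equal the claimed bound.\<close>

lemma abs_bern_bias_powr_le:
  assumes "m > 0" "p \<in> {0..1}" "0 < \<alpha>" "\<alpha> < 1"
  shows "\<bar>p powr \<alpha> - bern m (\<lambda>p. p powr \<alpha>) p\<bar> \<le> (1 / real m) powr \<alpha>"
proof (cases "p = 0")
  case False
  then have p: "p > 0" using assms by simp
  show ?thesis
  proof (cases "p \<le> 1 / real m")
    case True
    have "0 \<le> bern m (\<lambda>p. p powr \<alpha>) p"
      unfolding bern_def using assms by (intro sum_nonneg) (auto simp: Bernstein_nonneg)
    moreover have "bern m (\<lambda>p. p powr \<alpha>) p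
        \<le> bern m (\<lambda>x. p powr \<alpha> + \<alpha> * p powr \<alpha> / p * (x - p) + 0 * (x - p)\<^sup>2) p"
      using powr_tangent(1)[OF assms(3,4) p] assms by (intro bern_mono) auto
    then have "bern m (\<lambda>p. p powr \<alpha>) p \<le> p powr \<alpha>"
      using assms(1) by (subst (asm) bern_quadratic) auto
    moreover have "p powr \<alpha> \<le> (1 / real m) powr \<alpha>"
      using True assms p by (intro powr_mono2) auto
    ultimately show ?thesis by linarith
  next
    case False
    have "\<bar>p powr \<alpha> - bern m (\<lambda>p. p powr \<alpha>) p\<bar> \<le> p powr \<alpha> / p\<^sup>2 * (p / real m)"
      using abs_bern_bias_le[OF assms(1,2), of "p powr \<alpha> / p\<^sup>2" "\<lambda>p. p powr \<alpha>",
          OF _ powr_tangent[OF assms(3,4) p]] by simp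
    also have "\<dots> = p powr (\<alpha> - 1) * (1 / real m)"
      using p by (simp add: powr_diff power2_eq_square)
    \<comment> \<open>The exponent is negative, so the power is largest at the threshold
      1/m.\<close>
    also have "\<dots> \<le> (1 / real m) powr (\<alpha> - 1) * (1 / real m)"
      using False assms by (intro mult_right_mono powr_mono2') auto
    also have "\<dots> = (1 / real m) powr \<alpha>"
      using assms(1) powr_mult_base[of "1 / real m" "\<alpha> - 1"] by (simp add: mult.commute)
    finally show ?thesis .
  qed
qed (simp add: bern_at_0)

section \<open>Size of the operators for small p\<close>

text \<open>The linear correction turns the value at k/m into -(k/m) ln(nk/m). For k >= 1 one has 1
  <= nk/m <= Kk, so the logarithm lies between 0 and ln K + ln k, free of \<open>n\<close>.\<close>

lemma abs_bern_rescaled_xlnx_le: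
  assumes "0 < m" "m \<le> n" "real n \<le> K * real m" "K > 0" "p \<in> {0..1}" "real n * p \<le> 1"
  shows "\<bar>bern m (\<lambda>x. - x * ln x + (- ln (real n)) * x) p\<bar> \<le> p * (ln K + 1)"
proof -
  have "\<bar>bern m (\<lambda>x. - x * ln x + (- ln (real n)) * x) p\<bar> \<le>
     bern m (\<lambda>x. 0 + ln K / m * (real m * x) + 1 / m * (real m * x * (real m * x - 1))) p"
  proof (rule abs_bern_le[OF assms(5)])
    fix k :: nat assume "k \<le> m"
    show "\<bar>- (real k / real m) * ln (real k / real m) + (- ln (real n)) * (real k / real m)\<bar>
      \<le> 0 + ln K / m * (real m * (real k / real m))
         + 1 / m * (real m * (real k / real m) * (real m * (real k / real m) - 1))"
    proof (cases "k = 0")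
      case False
      then have k: "real k \<ge> 1" by simp
      have n: "real n > 0" using assms by simp
      have mn: "real m \<le> real n" using assms by simp
      have eq: "ln (real k / real m) + ln (real n) = ln (real n * real k / real m)"
        using k n assms(1) by (simp add: ln_div ln_mult)
      have "real m * 1 \<le> real n * real k" using k mn by (intro mult_mono) auto
      then have ge: "0 \<le> ln (real n * real k / real m)"
        using assms(1) by (intro ln_ge_zero) (simp add: field_simps)
      have "ln (real n * real k / real m) \<le> ln (K * real k)"
        using assms k n by (subst ln_le_cancel_iff) (auto simp: field_simps)
      also have "\<dots> = ln K + ln (real k)" using assms k by (simp add: ln_mult)
      \<comment> \<open>Bounding ln k by k - 1 makes the majorant a combination of k and k(k-1),
        whose means are explicit. Its second-order part is then controlled by n p <= 1.\<close>
      also have "\<dots> \<le> ln K + (real k - 1)" using k ln_le_minus_one[of "real k"] by simp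
      finally have le: "ln (real n * real k / real m) \<le> ln K + (real k - 1)" .
      have "\<bar>- (real k / real m) * ln (real k / real m) + (- ln (real n)) * (real k / real m)\<bar>
         = real k / real m * ln (real n * real k / real m)"
      proof -
        have "- (real k / real m) * ln (real k / real m) + (- ln (real n)) * (real k / real m)
            = - (real k / real m * ln (real n * real k / real m))"
          unfolding eq[symmetric] by (simp only: algebra_simps)
        then show ?thesis using ge by (simp add: abs_mult)
      qed
      also have "\<dots> \<le> real k / real m * (ln K + (real k - 1))"
        by (intro mult_left_mono le) auto
      also have "\<dots> = 0 + ln K / m * (real m * (real k / real m))
         + 1 / m * (real m * (real k / real m) * (real m * (real k / real m) - 1))"
        using assms(1) by (simp add: field_simps)
      finally show ?thesis .
    qed simp
  qed
  also have "\<dots> = p * (ln K + (real m - 1) * p)"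
    using assms(1) by (subst bern_factorial_moments) (simp_all add: field_simps power2_eq_square)
  also have "(real m - 1) * p \<le> real n * p"
    using assms by (intro mult_right_mono) auto
  then have "p * (ln K + (real m - 1) * p) \<le> p * (ln K + 1)"
    using assms by (intro mult_left_mono) auto
  finally show ?thesis .
qed

text \<open>The count k is an integer, so \<open>k powr \<alpha> \<le> k\<close>, and a linear
  function of k dominates the summand.\<close>

lemma abs_bern_powr_le:
  assumes "0 < m" "m \<le> n" "p \<in> {0..1}" "0 < \<alpha>" "\<alpha> < 1"
  shows "\<bar>bern m (\<lambda>x. x powr \<alpha>) p\<bar> \<le> p * real n powr (1 - \<alpha>)"
proof -
  have "\<bar>bern m (\<lambda>x. x powr \<alpha>) p\<bar>
      \<le> bern m (\<lambda>x. 0 + 1 / m powr \<alpha> * (real m * x) + 0 * (real m * x * (real m * x - 1))) p"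
  proof (rule abs_bern_le[OF assms(3)])
    fix k :: nat
    have "real k powr \<alpha> \<le> real k"
    proof (cases "k = 0")
      case False
      then have "real k powr \<alpha> \<le> real k powr 1"
        using assms by (intro powr_mono) auto
      then show ?thesis by simp
    qed simp
    then show "\<bar>(real k / real m) powr \<alpha>\<bar> \<le> 0 + 1 / m powr \<alpha> * (real m * (real k / real m))
        + 0 * (real m * (real k / real m) * (real m * (real k / real m) - 1))"
      using assms(1) by (simp add: powr_divide divide_right_mono)
  qed
  also have "\<dots> = p * (real m / real m powr \<alpha>)"
    using assms(1) by (subst bern_factorial_moments) simp_all
  also have "real m / real m powr \<alpha> = real m powr (1 - \<alpha>)"
    using assms(1) by (simp add: powr_diff)
  also have "p * real m powr (1 - \<alpha>) \<le> p * real n powr (1 - \<alpha>)"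
    using assms by (intro mult_left_mono powr_mono2) auto
  finally show ?thesis .
qed

section \<open>The sum of the jackknife coefficients\<close>

text \<open>Lagrange interpolation of the constant 1 at the nodes \<open>1 / x i\<close>, evaluated at 0.\<close>

lemma sum_prod_ratio_eq_1:
  fixes x :: "'i \<Rightarrow> real"
  assumes "finite I" "I \<noteq> {}" "inj_on x I" "\<And>i. i \<in> I \<Longrightarrow> x i \<noteq> 0"
  shows "(\<Sum>i\<in>I. \<Prod>j\<in>I - {i}. x i / (x i - x j)) = 1"
proof -
  define y where "y i = 1 / x i" for i
  have y: "y i \<noteq> y j" if "i \<in> I" "j \<in> I" "i \<noteq> j" for i j
    using assms that by (auto simp: y_def inj_on_def)
  define L where "L i = (\<Prod>j\<in>I - {i}. [:- y j / (y i - y j), 1 / (y i - y j):])" for i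
  have poly_L: "poly (L i) t = (\<Prod>j\<in>I - {i}. (t - y j) / (y i - y j))" for i t
    unfolding L_def poly_prod by (intro prod.cong) (auto simp: diff_divide_distrib)
  have "degree (L i) < card I" if "i \<in> I" for i
  proof -
    have "degree (L i) \<le> (\<Sum>j\<in>I - {i}. 1)"
      unfolding L_def using assms(1)
      by (intro order_trans[OF degree_prod_sum_le] sum_mono) auto
    also have "\<dots> < card I"
      using card_Diff1_less[OF assms(1) that] by simp
    finally show ?thesis .
  qed
  then have deg: "degree (\<Sum>i\<in>I. L i) < card I"
    using assms by (intro degree_sum_less) (auto simp: card_gt_0_iff)
  have L: "poly (L i) (y k) = (if i = k then 1 else 0)" if "i \<in> I" "k \<in> I" for i k
  proof (cases "i = k")
    case True
    have "(\<Prod>j\<in>I - {k}. (y k - y j) / (y k - y j)) = 1"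
      using y that by (intro prod.neutral) auto
    then show ?thesis using True by (simp add: poly_L)
  next
    case False
    then have "k \<in> I - {i}" using that by simp
    then have "poly (L i) (y k) = 0"
      unfolding poly_L using assms(1) by (intro prod_zero) auto
    then show ?thesis using False by simp
  qed
  have inj: "inj_on y I" using y by (auto simp: inj_on_def)
  \<comment> \<open>Both polynomials have degree below \<open>card I\<close> and agree at the
    \<open>card I\<close> distinct nodes.\<close>
  have "(\<Sum>i\<in>I. L i) = 1"
  proof (rule poly_eqI_degree[where A = "y ` I"])
    fix t assume "t \<in> y ` I"
    then obtain k where k: "k \<in> I" "t = y k" by auto
    have "poly (\<Sum>i\<in>I. L i) t = (\<Sum>i\<in>I. if i = k then 1 else 0)"
      unfolding poly_sum k(2) by (intro sum.cong) (auto simp: L k)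
    then show "poly (\<Sum>i\<in>I. L i) t = poly 1 t"
      using k assms(1) by simp
  qed (use deg in \<open>simp_all add: card_image[OF inj]\<close>)
  then have "(\<Sum>i\<in>I. poly (L i) 0) = 1"
    by (simp flip: poly_sum)
  moreover have "poly (L i) 0 = (\<Prod>j\<in>I - {i}. x i / (x i - x j))" if i: "i \<in> I" for i
    unfolding poly_L
  proof (rule prod.cong[OF refl])
    fix j assume "j \<in> I - {i}"
    then have "x i \<noteq> 0" "x j \<noteq> 0" "x i \<noteq> x j"
      using assms i by (auto simp: inj_on_def)
    then show "(0 - y j) / (y i - y j) = x i / (x i - x j)"
      unfolding y_def by (simp add: divide_simps) (auto simp: algebra_simps)
  qed
  ultimately show ?thesis by simp
qed

section \<open>From the sample to Bernstein operators\<close>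

text \<open>The number of successes inside \<open>S\<close> is binomial. Both the sample and the
  binomial law are written as images of one Boolean product measure, so the two expectations can be
  compared pointwise.\<close>

lemma expectation_subset_mean:
  assumes "S \<subseteq> {1..n}" "card S = m" "p \<in> {0..1}"
  shows "measure_pmf.expectation (bernoulli_sample n p) (\<lambda>x. f ((1 / real m) * (\<Sum>k\<in>S. x k)))
       = bern m f p"
proof -
  have fin: "finite S" using assms(1) finite_subset by blast
  \<comment> \<open>The defaults outside {1..n} match because \<open>of_bool False\<close> is
    0.\<close>
  have bs: "bernoulli_sample n p
      = map_pmf (\<lambda>h. of_bool \<circ> h) (Pi_pmf {1..n} False (\<lambda>_. bernoulli_pmf p))"
    unfolding bernoulli_sample_def by (rule Pi_pmf_map) auto
  have bin: "binomial_pmf m p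
      = map_pmf (\<lambda>h. card {k\<in>S. h k}) (Pi_pmf {1..n} False (\<lambda>_. bernoulli_pmf p))"
    unfolding binomial_pmf_altdef'[OF fin assms(2,3), of False]
      Pi_pmf_subset[OF finite_atLeastAtMost assms(1)] map_pmf_comp
    by (intro map_pmf_cong refl arg_cong[where f = card]) auto
  have "(\<Sum>k\<in>S. (of_bool (h k) :: real)) = real (card {k\<in>S. h k})" for h
    using fin by (simp add: of_bool_def sum.If_cases Int_def)
  then have "measure_pmf.expectation (bernoulli_sample n p) (\<lambda>x. f ((1 / real m) * (\<Sum>k\<in>S. x k)))
     = measure_pmf.expectation (binomial_pmf m p) (\<lambda>k. f (real k / real m))"
    unfolding bs bin by simp
  also have "\<dots> = bern m f p"
    unfolding expectation_binomial_pmf'[OF assms(3)] bern_def Bernstein_def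
    by (intro sum.cong) auto
  finally show ?thesis .
qed

lemma integrable_bernoulli_sample:
  fixes g :: "(nat \<Rightarrow> real) \<Rightarrow> real"
  shows "integrable (bernoulli_sample n p) g"
proof (rule integrable_measure_pmf_finite)
  show "finite (set_pmf (bernoulli_sample n p))"
    unfolding bernoulli_sample_def
    by (rule finite_subset[OF set_Pi_pmf_subset']) (auto intro!: finite_PiE_dflt)
qed

lemma expectation_ustat:
  assumes "m \<le> n" "p \<in> {0..1}"
  shows "measure_pmf.expectation (bernoulli_sample n p) (ustat n m f) = bern m f p"
proof -
  let ?A = "{S. S \<subseteq> {1..n} \<and> card S = m}"
  have "measure_pmf.expectation (bernoulli_sample n p) (ustat n m f)
     = (\<Sum>S\<in>?A. measure_pmf.expectation (bernoulli_sample n p)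
          (\<lambda>x. f ((1 / real m) * (\<Sum>k\<in>S. x k)))) / real (card ?A)"
    unfolding ustat_def by (simp add: integrable_bernoulli_sample Bochner_Integration.integral_sum)
  also have "\<dots> = (\<Sum>S\<in>?A. bern m f p) / real (card ?A)"
    by (intro arg_cong2[where f = "(/)"] sum.cong refl expectation_subset_mean assms) auto
  also have "\<dots> = bern m f p"
    \<comment> \<open>Since m <= n, there are n choose m > 0 subsets, so the division
      cancels.\<close>
    using assms(1) n_subsets[of "{1..n}" m] by simp
  finally show ?thesis .
qed

lemma jackknife_mean_eq:
  assumes "\<And>i. i \<in> {1..r} \<Longrightarrow> ns i \<le> n" "p \<in> {0..1}"
  shows "jackknife_mean r ns n f p = (\<Sum>i=1..r. jack_coeff r ns i * bern (ns i) f p)"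
  unfolding jackknife_mean_def jackknife_def
  using assms by (simp add: integrable_bernoulli_sample Bochner_Integration.integral_sum expectation_ustat)

section \<open>Sup norm and bias bounds for one admissible design\<close>

lemma unorm_le:
  assumes "\<And>p. p \<in> {0..1} \<Longrightarrow> \<bar>g p\<bar> \<le> B"
  shows "unorm g \<le> B"
  unfolding unorm_def by (rule cSUP_least) (use assms in auto)

text \<open>A real supremum dominates the values only of a set bounded above; \<open>B\<close>
  supplies that boundedness.\<close>

lemma abs_le_unorm:
  assumes "\<And>p. p \<in> {0..1} \<Longrightarrow> \<bar>g p\<bar> \<le> B" "q \<in> {0..1}"
  shows "\<bar>g q\<bar> \<le> unorm g"
  unfolding unorm_def by (rule cSUP_upper) (use assms in \<open>auto intro!: bdd_aboveI2[where M = B]\<close>)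

text \<open>One sample size with one admissible choice of subsample sizes. The bias bounds below
  depend on the sizes only through \<open>n\<close>, \<open>K\<close> and \<open>C\<close>, which
  gives the required uniformity.\<close>

locale jackknife_design =
  fixes r :: nat and K C :: real and n :: nat and ns :: "nat \<Rightarrow> nat"
  assumes r: "r \<ge> 1" and K: "K > 0" and sizes: "jackknife_sizes r K C n ns"
begin

lemma
  assumes "i \<in> {1..r}"
  shows size_pos: "0 < ns i" and size_le: "ns i \<le> n" and size_ge: "real n \<le> K * real (ns i)"
proof -
  have mono: "ns a \<le> ns b" if "a \<in> {1..r}" "b \<in> {1..r}" "a \<le> b" for a b
    using sizes that unfolding jackknife_sizes_def
    by (cases "a = b") (auto simp: strict_mono_on_def less_imp_le)
  show "0 < ns i" using sizes assms by (auto simp: jackknife_sizes_def)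
  show "ns i \<le> n"
    using mono[of i r] sizes assms by (auto simp: jackknife_sizes_def)
  have "real n \<le> K * real (ns 1)" using sizes by (simp add: jackknife_sizes_def)
  also have "\<dots> \<le> K * real (ns i)" using mono[of 1 i] assms r K by simp
  finally show "real n \<le> K * real (ns i)" .
qed

lemma n_pos: "n > 0"
  using size_pos[of 1] size_le[of 1] r by simp

lemma sum_jack_coeff: "(\<Sum>i=1..r. jack_coeff r ns i) = 1"
  unfolding jack_coeff_def
proof (rule sum_prod_ratio_eq_1[where x = "\<lambda>i. real (ns i)"])
  show "inj_on (\<lambda>i. real (ns i)) {1..r}"
  proof -
    have "strict_mono_on {1..r} ns" using sizes by (simp only: jackknife_sizes_def)
    then have "inj_on ns {1..r}" by (rule strict_mono_on_imp_inj_on)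
    then show ?thesis by (simp only: inj_on_def of_nat_eq_iff)
  qed
  show "real (ns i) \<noteq> 0" if "i \<in> {1..r}" for i
    using size_pos[OF that] by simp
qed (use r in auto)

lemma abs_jack_combination_le:
  assumes "\<And>i. i \<in> {1..r} \<Longrightarrow> \<bar>h i\<bar> \<le> B" "B \<ge> 0"
  shows "\<bar>\<Sum>i=1..r. jack_coeff r ns i * h i\<bar> \<le> C * B"
proof -
  have "\<bar>\<Sum>i=1..r. jack_coeff r ns i * h i\<bar> \<le> (\<Sum>i=1..r. \<bar>jack_coeff r ns i\<bar> * B)"
    by (rule order_trans[OF sum_abs])
      (use assms in \<open>auto simp: abs_mult intro!: sum_mono mult_left_mono\<close>)
  also have "\<dots> = (\<Sum>i=1..r. \<bar>jack_coeff r ns i\<bar>) * B"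
    by (simp add: sum_distrib_right)
  also have "\<dots> \<le> C * B"
    using sizes assms by (intro mult_right_mono) (auto simp: jackknife_sizes_def)
  finally show ?thesis .
qed

lemma bias_eq:
  assumes "p \<in> {0..1}"
  shows "f p - jackknife_mean r ns n f p = (\<Sum>i=1..r. jack_coeff r ns i * (f p - bern (ns i) f p))"
proof -
  have "(\<Sum>i=1..r. jack_coeff r ns i * f p) = f p"
    by (simp only: sum_distrib_right[symmetric] sum_jack_coeff mult_1)
  then show ?thesis
    by (simp only: jackknife_mean_eq[OF size_le assms] right_diff_distrib sum_subtractf)
qed

text \<open>Operators and coefficient sum both preserve linear functions, so a linear term may be
  added without changing the bias. \<open>bias_xlnx_ge\<close> takes c = -ln n.\<close>

lemma bias_eq_add_linear:
  assumes "p \<in> {0..1}"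
  shows "f p - jackknife_mean r ns n f p =
    f p + c * p - (\<Sum>i=1..r. jack_coeff r ns i * bern (ns i) (\<lambda>x. f x + c * x) p)"
proof -
  have "(\<Sum>i=1..r. jack_coeff r ns i * (c * p)) = c * p"
    by (simp only: sum_distrib_right[symmetric] sum_jack_coeff mult_1)
  moreover have "(\<Sum>i=1..r. jack_coeff r ns i * bern (ns i) (\<lambda>x. f x + c * x) p)
     = (\<Sum>i=1..r. jack_coeff r ns i * bern (ns i) f p + jack_coeff r ns i * (c * p))"
    using size_pos by (intro sum.cong) (auto simp: bern_add_linear distrib_left)
  ultimately show ?thesis
    by (simp only: jackknife_mean_eq[OF size_le assms] sum.distrib)
qed

lemma bias_xlnx_le:
  assumes "p \<in> {0..1}"
  shows "\<bar>- p * ln p - jackknife_mean r ns n (\<lambda>p. - p * ln p) p\<bar> \<le> C * (K / real n)"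
proof -
  have "\<bar>- p * ln p - bern (ns i) (\<lambda>p. - p * ln p) p\<bar> \<le> K / real n" if "i \<in> {1..r}" for i
  proof -
    have "\<bar>- p * ln p - bern (ns i) (\<lambda>p. - p * ln p) p\<bar> \<le> 1 / real (ns i)"
      by (rule abs_bern_bias_xlnx_le[OF size_pos[OF that] assms])
    also have "\<dots> \<le> K / real n"
      using size_ge[OF that] size_pos[OF that] n_pos by (simp add: field_simps)
    finally show ?thesis .
  qed
  then show ?thesis
    unfolding bias_eq[OF assms, of "\<lambda>p. - p * ln p"]
    using K by (intro abs_jack_combination_le) auto
qed

lemma bias_powr_le:
  assumes "p \<in> {0..1}" "0 < \<alpha>" "\<alpha> < 1"
  shows "\<bar>p powr \<alpha> - jackknife_mean r ns n (\<lambda>p. p powr \<alpha>) p\<bar> \<le> C * (K / real n) powr \<alpha>"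
proof -
  have "\<bar>p powr \<alpha> - bern (ns i) (\<lambda>p. p powr \<alpha>) p\<bar> \<le> (K / real n) powr \<alpha>" if "i \<in> {1..r}" for i
  proof -
    have "\<bar>p powr \<alpha> - bern (ns i) (\<lambda>p. p powr \<alpha>) p\<bar> \<le> (1 / real (ns i)) powr \<alpha>"
      by (rule abs_bern_bias_powr_le[OF size_pos[OF that] assms])
    also have "\<dots> \<le> (K / real n) powr \<alpha>"
      using size_ge[OF that] size_pos[OF that] n_pos assms
      by (intro powr_mono2) (auto simp: field_simps)
    finally show ?thesis .
  qed
  then show ?thesis
    unfolding bias_eq[OF assms(1), of "\<lambda>p. p powr \<alpha>"]
    by (intro abs_jack_combination_le) auto
qed

lemma bias_xlnx_ge:
  assumes "0 < x" "x \<le> 1" "p = x / real n"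
  shows "p * (- ln x - C * (ln K + 1)) \<le> - p * ln p - jackknife_mean r ns n (\<lambda>p. - p * ln p) p"
proof -
  have p: "p \<in> {0..1}" unfolding assms(3) using assms(1,2) n_pos by (auto simp: field_simps)
  \<comment> \<open>Forced by n_1 <= n <= K n_1. It makes ln K + 1 nonnegative, as the bound on the
    combination requires.\<close>
  have K1: "K \<ge> 1"
  proof -
    have "real (ns 1) * 1 \<le> real (ns 1) * K"
      using size_le[of 1] size_ge[of 1] r by (simp add: mult.commute)
    then show ?thesis using size_pos[of 1] r by simp
  qed
  have "\<bar>\<Sum>i=1..r. jack_coeff r ns i * bern (ns i) (\<lambda>x. - x * ln x + (- ln (real n)) * x) p\<bar>
      \<le> C * (p * (ln K + 1))"
    using K1 p assms n_pos
    by (intro abs_jack_combination_le abs_bern_rescaled_xlnx_le size_pos size_le size_ge K) auto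
  \<comment> \<open>Here n p = x, so the corrected main term is -p ln(n p).\<close>
  moreover have "- p * ln p + (- ln (real n)) * p = p * - ln x"
    using assms n_pos by (simp add: ln_div algebra_simps)
  ultimately show ?thesis
    unfolding bias_eq_add_linear[OF p, of "\<lambda>p. - p * ln p" "- ln (real n)"]
    by (simp add: algebra_simps)
qed

text \<open>In units of \<open>n powr -\<alpha>\<close> the main term is
  \<open>x powr \<alpha>\<close> and the operators contribute at most C x, which is of lower order
  as x tends to 0.\<close>

lemma bias_powr_ge:
  assumes "0 < x" "x \<le> 1" "p = x / real n" "0 < \<alpha>" "\<alpha> < 1"
  shows "(x powr \<alpha> - C * x) / real n powr \<alpha> \<le> p powr \<alpha> - jackknife_mean r ns n (\<lambda>p. p powr \<alpha>) p"
proof -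
  have p: "p \<in> {0..1}" unfolding assms(3) using assms(1,2) n_pos by (auto simp: field_simps)
  have "\<bar>\<Sum>i=1..r. jack_coeff r ns i * bern (ns i) (\<lambda>x. x powr \<alpha>) p\<bar>
      \<le> C * (p * real n powr (1 - \<alpha>))"
    using p assms
    by (intro abs_jack_combination_le abs_bern_powr_le size_pos size_le) auto
  moreover have "p * real n powr (1 - \<alpha>) = x / real n powr \<alpha>"
    using assms n_pos by (simp add: powr_diff)
  moreover have "p powr \<alpha> = x powr \<alpha> / real n powr \<alpha>"
    using assms by (simp add: powr_divide)
  ultimately show ?thesis
    using jackknife_mean_eq[of r ns n p "\<lambda>x. x powr \<alpha>"] size_le p
    by (simp add: diff_divide_distrib)
qed

end

section \<open>Choice of the constants\<close>

theorem corollary1: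
  fixes r :: nat and K C :: real
  assumes "r \<ge> 1" and "K > 0" and "C > 0"
  shows "jackknife_asymp r K C
           (\<lambda>n ns. unorm (\<lambda>p. - p * ln p - jackknife_mean r ns n (\<lambda>p. - p * ln p) p))
           (\<lambda>n. 1 / real n) \<and>
         (\<forall>\<alpha>::real. 0 < \<alpha> \<and> \<alpha> < 1 \<longrightarrow>
            jackknife_asymp r K C
              (\<lambda>n ns. unorm (\<lambda>p. p powr \<alpha> - jackknife_mean r ns n (\<lambda>p. p powr \<alpha>) p))
              (\<lambda>n. 1 / real n powr \<alpha>))"
proof (intro conjI allI impI)
  \<comment> \<open>Chosen so that -ln x exceeds C(ln K + 1) by at least 1. The absolute value keeps
    the exponent negative, hence x <= 1, whatever the sign of ln K.\<close>
  define x where "x = exp (- (C * (\<bar>ln K\<bar> + 1) + 1))"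
  have "0 \<le> C * (\<bar>ln K\<bar> + 1)" using assms(3) by simp
  then have x: "0 < x" "x \<le> 1" by (simp_all add: x_def)
  show "jackknife_asymp r K C
           (\<lambda>n ns. unorm (\<lambda>p. - p * ln p - jackknife_mean r ns n (\<lambda>p. - p * ln p) p))
           (\<lambda>n. 1 / real n)"
    unfolding jackknife_asymp_def
  \<comment> \<open>\<open>C * K\<close> serves the upper bound and \<open>1 / x\<close> the lower
    one; their sum serves both and is independent of \<open>n\<close> and the sizes.\<close>
  proof (intro exI[of _ "C * K + 1 / x"] conjI allI impI)
    show "C * K + 1 / x > 0" using assms x by (simp add: add_pos_pos)
    fix n ns assume "jackknife_sizes r K C n ns"
    then interpret jackknife_design r K C n ns using assms by unfold_locales
    define a where "a = unorm (\<lambda>p. - p * ln p - jackknife_mean r ns n (\<lambda>p. - p * ln p) p)"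
    have p: "x / real n \<in> {0..1}" using x n_pos by (auto simp: field_simps)
    have "C * (ln K + 1) \<le> C * (\<bar>ln K\<bar> + 1)" using assms by simp
    then have "1 \<le> - ln x - C * (ln K + 1)" by (simp add: x_def)
    then have "x / real n * 1 \<le> x / real n * (- ln x - C * (ln K + 1))"
      using x by (intro mult_left_mono) auto
    also note bias_xlnx_ge[OF x refl]
    also have "- (x / real n) * ln (x / real n)
        - jackknife_mean r ns n (\<lambda>p. - p * ln p) (x / real n) \<le> a"
      unfolding a_def using abs_le_unorm[of "\<lambda>p. - p * ln p - jackknife_mean r ns n (\<lambda>p. - p * ln p) p",
          OF bias_xlnx_le p] by linarith
    finally have lower: "x / real n \<le> a" by simp
    then have "a \<ge> 0" using x by (meson divide_nonneg_nonneg less_imp_le of_nat_0_le_iff order_trans)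
    have "a \<le> C * (K / real n)"
      unfolding a_def by (rule unorm_le[OF bias_xlnx_le])
    also have "\<dots> = C * K * (1 / real n)"
      by simp
    also have "\<dots> \<le> (C * K + 1 / x) * (1 / real n)"
      using x by (intro mult_right_mono) auto
    finally show "a \<le> (C * K + 1 / x) * (1 / real n)" .
    have "1 / real n \<le> 1 / x * a"
      using lower x by (simp add: field_simps)
    also have "\<dots> \<le> (C * K + 1 / x) * a"
      using assms \<open>a \<ge> 0\<close> by (intro mult_right_mono) auto
    finally show "1 / real n \<le> (C * K + 1 / x) * a" .
  qed
next
  fix \<alpha> :: real
  assume "0 < \<alpha> \<and> \<alpha> < 1"
  then have \<alpha>: "0 < \<alpha>" "\<alpha> < 1" by auto
  \<comment> \<open>Solves \<open>x powr (1 - \<alpha>) = 1 / (2 * (C + 1))\<close>, so that C x is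
    at most half of \<open>x powr \<alpha>\<close>.\<close>
  define x where "x = (1 / (2 * (C + 1))) powr (1 / (1 - \<alpha>))"
  have x: "0 < x" "x \<le> 1"
    unfolding x_def using assms(3) \<alpha> by (auto intro!: powr_le1)
  have x1: "x powr (1 - \<alpha>) = 1 / (2 * (C + 1))"
    unfolding x_def powr_powr using assms(3) \<alpha> by simp
  have "x = x powr \<alpha> * x powr (1 - \<alpha>)"
    using x by (simp flip: powr_add)
  then have "C * x = C * (x powr \<alpha> * x powr (1 - \<alpha>))"
    by (rule arg_cong)
  also have "\<dots> = x powr \<alpha> * (C / (2 * (C + 1)))"
    by (simp add: x1)
  also have "\<dots> \<le> x powr \<alpha> * (1 / 2)"
    using assms(3) by (intro mult_left_mono) (auto simp: field_simps)
  finally have Cx: "x powr \<alpha> / 2 \<le> x powr \<alpha> - C * x" by simp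
  define d where "d = x powr \<alpha> / 2"
  have d: "d > 0" using x by (simp add: d_def)
  show "jackknife_asymp r K C
              (\<lambda>n ns. unorm (\<lambda>p. p powr \<alpha> - jackknife_mean r ns n (\<lambda>p. p powr \<alpha>) p))
              (\<lambda>n. 1 / real n powr \<alpha>)"
    unfolding jackknife_asymp_def
  proof (intro exI[of _ "C * K powr \<alpha> + 1 / d"] conjI allI impI)
    show "C * K powr \<alpha> + 1 / d > 0" using assms d by (simp add: add_pos_pos)
    fix n ns assume "jackknife_sizes r K C n ns"
    then interpret jackknife_design r K C n ns using assms by unfold_locales
    define a where "a = unorm (\<lambda>p. p powr \<alpha> - jackknife_mean r ns n (\<lambda>p. p powr \<alpha>) p)"
    have n: "real n powr \<alpha> > 0" using n_pos by simp
    have p: "x / real n \<in> {0..1}" using x n_pos by (auto simp: field_simps)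
    have "d / real n powr \<alpha> \<le> (x powr \<alpha> - C * x) / real n powr \<alpha>"
      using Cx by (intro divide_right_mono) (auto simp: d_def)
    also note bias_powr_ge[OF x refl \<alpha>]
    also have "(x / real n) powr \<alpha> - jackknife_mean r ns n (\<lambda>p. p powr \<alpha>) (x / real n) \<le> a"
      unfolding a_def using abs_le_unorm[of "\<lambda>p. p powr \<alpha> - jackknife_mean r ns n (\<lambda>p. p powr \<alpha>) p",
          OF bias_powr_le[OF _ \<alpha>] p] by linarith
    finally have lower: "d / real n powr \<alpha> \<le> a" .
    then have "a \<ge> 0" using d n by (meson divide_pos_pos less_imp_le order_trans)
    have "a \<le> C * (K / real n) powr \<alpha>"
      unfolding a_def by (rule unorm_le[OF bias_powr_le[OF _ \<alpha>]])
    also have "\<dots> = C * K powr \<alpha> * (1 / real n powr \<alpha>)"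
      using assms by (simp add: powr_divide)
    also have "\<dots> \<le> (C * K powr \<alpha> + 1 / d) * (1 / real n powr \<alpha>)"
      using d by (intro mult_right_mono) auto
    finally show "a \<le> (C * K powr \<alpha> + 1 / d) * (1 / real n powr \<alpha>)" .
    have "1 / real n powr \<alpha> \<le> 1 / d * a"
      using lower d by (simp add: field_simps)
    also have "\<dots> \<le> (C * K powr \<alpha> + 1 / d) * a"
      using assms \<open>a \<ge> 0\<close> by (intro mult_right_mono) auto
    finally show "1 / real n powr \<alpha> \<le> (C * K powr \<alpha> + 1 / d) * a" .
  qed
qed

end
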